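(* Let $p$ be a prime, let $g\in\mathbb{Z}[X]$ be monic, and let $f(X)=g(X^p)$ be irreducible with root $\theta$. If $g(\omega(c))\equiv 0\pmod{p^2}$ for some $c\in\{0,\dots,p-1\}$, then $p\mid I(\theta)$; in particular $f$ is not monogenic.
   Context: For $c\in\mathbb{Z}$, $\omega(c)\in\mathbb{Z}/p^2\mathbb{Z}$ denotes the residue class of $c^p$ modulo $p^2$ (it depends only on $c$ modulo $p$). Let $K=\mathbb{Q}(\theta)$ with ring of integers $\mathcal{O}_K$; $I(\theta)=[\mathcal{O}_K:\mathbb{Z}[\theta]]$ denotes the index. The polynomial $f$ is called monogenic if $I(\theta)=1$, i.e. $\mathbb{Z}[\theta]=\mathcal{O}_K$. Irreducible means irreducible over $\mathbb{Q}$. *)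

theory Defs
  imports
    "HOL-Algebra.Algebraic_Closure_Type"
    "HOL-Algebra.Generated_Fields"
    "HOL-Number_Theory.Cong"
begin

hide_const (open) Divisibility.prime Divisibility.irreducible

text \<open>
  Residue classes modulo \<open>p\<^sup>2\<close> are represented by integers in \<open>{0..<p\<^sup>2}\<close>.
\<close>

definition omega :: "nat \<Rightarrow> int \<Rightarrow> int" where
  "omega p c = c ^ p mod (int p)\<^sup>2"

text \<open>
  Number fields are taken inside the complex numbers, regarded as a ring record by
  \<^const>\<open>ring_of_type_algebra\<close>.  A subfield of the complex numbers contains the rationals, so the
  subfield generated by \<open>\<theta>\<close> is \<open>\<rat>(\<theta>)\<close>, and the subring generated by \<open>\<theta>\<close> is \<open>\<int>[\<theta>]\<close>.
\<close>

definition rat_adjoin :: "complex \<Rightarrow> complex set" where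
  "rat_adjoin \<theta> = generate_field ring_of_type_algebra {\<theta>}"

definition int_adjoin :: "complex \<Rightarrow> complex set" where
  "int_adjoin \<theta> = generate_ring ring_of_type_algebra {\<theta>}"

definition ring_of_integers :: "complex set \<Rightarrow> complex ring" where
  "ring_of_integers K = ring_of_type_algebra \<lparr>carrier := {x \<in> K. algebraic_int x}\<rparr>"

text \<open>
  The index of \<open>\<int>[\<theta>]\<close> in the ring of integers of \<open>\<rat>(\<theta>)\<close>, as additive groups.  It is meant for
  algebraic integers \<open>\<theta>\<close>; then the set of cosets is finite, so the value 0 of \<^const>\<open>card\<close> on
  infinite sets does not occur.
\<close>

definition index :: "complex \<Rightarrow> nat" where
  "index \<theta> = card (a_rcosets\<^bsub>ring_of_integers (rat_adjoin \<theta>)\<^esub> (int_adjoin \<theta>))"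

text \<open>
  Only meant for monic polynomials that are irreducible over the rationals.  For these the index
  is the same for all roots, so it does not matter which root is chosen.
\<close>

definition monogenic :: "int poly \<Rightarrow> bool" where
  "monogenic f \<longleftrightarrow> (\<exists>\<theta>. poly (map_poly of_int f) \<theta> = 0 \<and> index \<theta> = 1)"

end

theory Submission
  imports "Jordan_Normal_Form.Char_Poly" Defs
begin

text \<open>
  Since \<open>f = g(X\<^sup>p)\<close> has derivative \<open>p X\<^sup>p\<^sup>-\<^sup>1 g'(X\<^sup>p)\<close>, the hypothesis says that
  \<open>f(c) = p\<^sup>2 b\<^sub>0\<close> and \<open>f'(c) = p b\<^sub>1\<close>.  Dividing twice by \<open>X - c\<close> gives
  \<open>f = (X - c) H + p b\<^sub>1 (X - c) + p\<^sup>2 b\<^sub>0\<close> with \<open>H = (X - c) q\<close> monic of degree \<open>deg f - 1\<close>.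
  The element \<open>x = H(\<theta>) / p\<close> satisfies \<open>x\<^sup>2 + b\<^sub>1 x = - b\<^sub>0 q(\<theta>)\<close>, so it is integral, but it is
  not in \<open>\<int>[\<theta>]\<close> because \<open>H\<close> is monic of degree less than \<open>deg f\<close>.  Its coset therefore has
  order \<open>p\<close> in the quotient of \<open>\<O>\<close> by \<open>\<int>[\<theta>]\<close>.
\<close>

hide_const (open) up_ring.monom up_ring.coeff module.smult Polynomials.lead_coeff Polynomials.degree

section \<open>Algebraic integers via finitely generated \<int>-modules\<close>

text \<open>The characteristic polynomial is monic, and it already has integer coefficients because
  forming it commutes with \<open>of_int\<close>.\<close>

lemma algebraic_int_eigenvalue:
  fixes A :: "int mat" and x :: "'a :: field_char_0"
  assumes A: "A \<in> carrier_mat n n" and ev: "eigenvalue (map_mat of_int A) x"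
  shows "algebraic_int x"
proof -
  have "poly (char_poly (map_mat of_int A)) x = 0"
    using eigenvalue_root_char_poly[of "map_mat of_int A :: 'a mat" n x] A ev by simp
  then have "poly (of_int_poly (char_poly A)) x = 0"
    by (simp add: of_int_hom.char_poly_hom[OF A])
  moreover have "lead_coeff (char_poly A) = 1"
    using degree_monic_char_poly[OF A] by simp
  ultimately show ?thesis
    unfolding algebraic_int_altdef_ipoly by blast
qed

text \<open>The \<int>-module generated by a family. Indexing by \<open>I\<close> rather than taking
  a set of generators lets products of two families be indexed by pairs, whatever coincidences
  occur. For infinite \<open>I\<close> the sum is 0 by convention, so the span is then
  trivial.\<close>

definition int_span :: "'i set \<Rightarrow> ('i \<Rightarrow> 'a :: comm_ring_1) \<Rightarrow> 'a set" where
  "int_span I s = range (\<lambda>c :: 'i \<Rightarrow> int. \<Sum>i\<in>I. of_int (c i) * s i)"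

lemma int_spanI: "x = (\<Sum>i\<in>I. of_int (c i) * s i) \<Longrightarrow> x \<in> int_span I s"
  by (auto simp: int_span_def)

lemma int_span_base: "finite I \<Longrightarrow> i \<in> I \<Longrightarrow> s i \<in> int_span I s"
  by (rule int_spanI[where c = "\<lambda>j. if j = i then 1 else 0"])
     (simp add: if_distrib[of of_int] if_distribR if_distrib[of "\<lambda>x. x * _"] cong: if_cong)

lemma int_span_0: "0 \<in> int_span I s"
  by (rule int_spanI[where c = "\<lambda>_. 0"]) simp

lemma int_span_add: "x \<in> int_span I s \<Longrightarrow> y \<in> int_span I s \<Longrightarrow> x + y \<in> int_span I s"
proof -
  assume "x \<in> int_span I s" "y \<in> int_span I s"
  then obtain c d where "x = (\<Sum>i\<in>I. of_int (c i) * s i)" "y = (\<Sum>i\<in>I. of_int (d i) * s i)"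
    by (auto simp: int_span_def)
  then show ?thesis
    by (intro int_spanI[where c = "\<lambda>i. c i + d i"]) (simp add: algebra_simps sum.distrib)
qed

lemma int_span_scale: "x \<in> int_span I s \<Longrightarrow> of_int k * x \<in> int_span I s"
proof -
  assume "x \<in> int_span I s"
  then obtain c where "x = (\<Sum>i\<in>I. of_int (c i) * s i)"
    by (auto simp: int_span_def)
  then show ?thesis
    by (intro int_spanI[where c = "\<lambda>i. k * c i"]) (simp add: sum_distrib_left mult.assoc)
qed

lemma int_span_sum: "(\<And>j. j \<in> J \<Longrightarrow> h j \<in> int_span I s) \<Longrightarrow> sum h J \<in> int_span I s"
  by (induction J rule: infinite_finite_induct) (auto intro: int_span_0 int_span_add)

lemma int_span_mult_closed:
  assumes "\<And>i. i \<in> I \<Longrightarrow> x * s i \<in> int_span I s" and "y \<in> int_span I s"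
  shows "x * y \<in> int_span I s"
proof -
  obtain c where "y = (\<Sum>i\<in>I. of_int (c i) * s i)"
    using assms(2) by (auto simp: int_span_def)
  then have "x * y = (\<Sum>i\<in>I. of_int (c i) * (x * s i))"
    by (simp add: sum_distrib_left mult_ac)
  then show ?thesis
    using assms(1) by (auto intro!: int_span_sum int_span_scale)
qed

text \<open>The determinant trick: writing each \<open>x * s i\<close> in the generators gives an
  integer matrix for which the vector of generators is an eigenvector with eigenvalue
  \<open>x\<close>. The generator \<open>s k\<close> ensures that this vector is nonzero.\<close>

lemma algebraic_int_if_int_span_closed:
  fixes x :: "'a :: field_char_0"
  assumes fin: "finite I" and mult: "\<And>i. i \<in> I \<Longrightarrow> x * s i \<in> int_span I s"
    and nz: "k \<in> I" "s k \<noteq> 0"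
  shows "algebraic_int x"
proof -
  define n where "n = card I"
  obtain b where b: "bij_betw b {0..<n} I"
    using ex_bij_betw_nat_finite[OF fin] by (auto simp: n_def)
  have "\<exists>c :: _ \<Rightarrow> int. x * s i = (\<Sum>j\<in>I. of_int (c j) * s j)" if "i \<in> I" for i
    using mult[OF that] by (auto simp: int_span_def)
  then obtain C :: "_ \<Rightarrow> _ \<Rightarrow> int" where C: "\<And>i. i \<in> I \<Longrightarrow> x * s i = (\<Sum>j\<in>I. of_int (C i j) * s j)"
    by metis
  define A :: "int mat" where "A = mat n n (\<lambda>(i, j). C (b i) (b j))"
  define v where "v = vec n (\<lambda>i. s (b i))"
  have A: "A \<in> carrier_mat n n" by (simp add: A_def)
  have "map_mat of_int A *\<^sub>v v = x \<cdot>\<^sub>v v"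
  proof (rule eq_vecI)
    fix i assume "i < dim_vec (x \<cdot>\<^sub>v v)"
    then have i: "i < n" by (simp add: v_def)
    then have bi: "b i \<in> I" using b by (auto simp: bij_betw_def)
    have "(map_mat of_int A *\<^sub>v v) $ i = (\<Sum>j\<in>{0..<n}. of_int (C (b i) (b j)) * s (b j))"
      using i by (auto simp: A_def v_def scalar_prod_def intro!: sum.cong)
    also have "\<dots> = (\<Sum>j\<in>I. of_int (C (b i) j) * s j)"
      using sum.reindex_bij_betw[OF b, of "\<lambda>j. of_int (C (b i) j) * s j"] .
    also have "\<dots> = (x \<cdot>\<^sub>v v) $ i"
      using C[OF bi] i by (simp add: v_def)
    finally show "(map_mat of_int A *\<^sub>v v) $ i = (x \<cdot>\<^sub>v v) $ i" .
  qed (simp add: A_def v_def)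
  moreover have "v \<noteq> 0\<^sub>v n"
  proof
    obtain i where "i < n" "b i = k" using b nz(1) by (auto simp: bij_betw_def)
    moreover assume "v = 0\<^sub>v n"
    then have "v $ i = 0" using \<open>i < n\<close> by simp
    ultimately show False using nz(2) by (simp add: v_def)
  qed
  ultimately have "eigenvalue (map_mat of_int A) x"
    unfolding eigenvalue_def eigenvector_def by (intro exI[of _ v]) (auto simp: A_def v_def)
  then show ?thesis by (rule algebraic_int_eigenvalue[OF A])
qed

lemma algebraic_int_power_relation:
  fixes x :: "'a :: field_char_0"
  assumes "algebraic_int x"
  obtains n and a :: "nat \<Rightarrow> int" where "n > 0" "x ^ n = (\<Sum>k<n. of_int (a k) * x ^ k)"
proof -
  obtain q where q: "poly (of_int_poly q) x = 0" "lead_coeff q = 1"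
    using assms by (auto simp: algebraic_int_altdef_ipoly)
  define n where "n = degree q"
  \<comment> \<open>A monic constant polynomial is 1, which has no root.\<close>
  have "n > 0"
  proof (rule ccontr)
    assume "\<not> n > 0"
    then have "q = 1" using q(2) by (auto simp: n_def elim!: degree_eq_zeroE)
    with q(1) show False by simp
  qed
  moreover have "0 = (\<Sum>k\<le>n. of_int (coeff q k) * x ^ k)"
    using q(1) by (simp add: poly_altdef n_def)
  then have "x ^ n = (\<Sum>k<n. of_int (- coeff q k) * x ^ k)"
    using q(2) by (simp add: n_def lessThan_Suc_atMost[symmetric] sum_negf eq_neg_iff_add_eq_0 add.commute)
  ultimately show ?thesis by (rule that)
qed

text \<open>Multiplication by \<open>x\<close> shifts the powers by one; only the top power leaves
  the list, and the integral relation brings it back.\<close>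

lemma int_span_powers_closed:
  fixes x :: "'a :: field_char_0"
  assumes n: "n > 0" "x ^ n = (\<Sum>k<n. of_int (a k) * x ^ k)" and i: "i < n"
  shows "x * x ^ i \<in> int_span {..<n} (\<lambda>k. x ^ k)"
proof (cases "Suc i < n")
  case True
  then show ?thesis using int_span_base[of "{..<n}" "Suc i" "\<lambda>k. x ^ k"] by simp
next
  case False
  then have "Suc i = n" using i by simp
  then show ?thesis using n(2) by (intro int_spanI[where c = a]) (metis power_Suc)
qed

lemma int_span_times_left:
  assumes "u \<in> int_span I s" "j \<in> J" "finite J"
  shows "u * t j \<in> int_span (I \<times> J) (\<lambda>(i, j). s i * t j)"
proof -
  obtain c where u: "u = (\<Sum>i\<in>I. of_int (c i) * s i)"
    using assms(1) by (auto simp: int_span_def)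
  show ?thesis
  \<comment> \<open>If \<open>I\<close> is infinite, the sum defining \<open>u\<close> is 0.\<close>
  proof (cases "finite I")
    case True
    have "u * t j = (\<Sum>i\<in>I. of_int (c i) * (case (i, j) of (i, j) \<Rightarrow> s i * t j))"
      by (simp add: u sum_distrib_right mult.assoc)
    also have "\<dots> \<in> int_span (I \<times> J) (\<lambda>(i, j). s i * t j)"
      using True assms by (intro int_span_sum int_span_scale int_span_base) auto
    finally show ?thesis .
  qed (simp add: u int_span_0)
qed

lemma int_span_times_right:
  assumes "u \<in> int_span J t" "i \<in> I" "finite I"
  shows "s i * u \<in> int_span (I \<times> J) (\<lambda>(i, j). s i * t j)"
proof -
  obtain c where u: "u = (\<Sum>j\<in>J. of_int (c j) * t j)"
    using assms(1) by (auto simp: int_span_def)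
  show ?thesis
  proof (cases "finite J")
    case True
    have "s i * u = (\<Sum>j\<in>J. of_int (c j) * (case (i, j) of (i, j) \<Rightarrow> s i * t j))"
      by (simp add: u sum_distrib_left mult_ac)
    also have "\<dots> \<in> int_span (I \<times> J) (\<lambda>(i, j). s i * t j)"
      using True assms by (intro int_span_sum int_span_scale int_span_base) auto
    finally show ?thesis .
  qed (simp add: u int_span_0)
qed

text \<open>The monomials \<open>x ^ i * y ^ j\<close> with \<open>i < m\<close>,
  \<open>j < n\<close> span a module stable under multiplication by \<open>x\<close> and by
  \<open>y\<close>, hence under \<open>x + y\<close> and \<open>x * y\<close>.\<close>

lemma
  fixes x y :: "'a :: field_char_0"
  assumes "algebraic_int x" "algebraic_int y"
  shows algebraic_int_plus: "algebraic_int (x + y)"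
    and algebraic_int_times: "algebraic_int (x * y)"
proof -
  obtain m a where m: "m > 0" "x ^ m = (\<Sum>k<m. of_int (a k) * x ^ k)"
    using algebraic_int_power_relation[OF assms(1)] .
  obtain n b where n: "n > 0" "y ^ n = (\<Sum>k<n. of_int (b k) * y ^ k)"
    using algebraic_int_power_relation[OF assms(2)] .
  define I where "I = {..<m} \<times> {..<n}"
  define s where "s = (\<lambda>(i, j). x ^ i * y ^ j)"
  have fin: "finite I" by (simp add: I_def)
  have x: "x * s i \<in> int_span I s" if "i \<in> I" for i
    using int_span_times_left[OF int_span_powers_closed[OF m],
        of "fst i" "snd i" "{..<n}" "\<lambda>j. y ^ j"] that
    by (auto simp: I_def s_def mult_ac)
  have y: "y * s i \<in> int_span I s" if "i \<in> I" for i
    using int_span_times_right[OF int_span_powers_closed[OF n],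
        of "snd i" "fst i" "{..<m}" "\<lambda>j. x ^ j"] that
    by (auto simp: I_def s_def mult_ac)
  \<comment> \<open>The nonzero generator is the monomial 1, which is in the family because
    \<open>m\<close> and \<open>n\<close> are positive.\<close>
  have k: "(0, 0) \<in> I" "s (0, 0) \<noteq> 0" using m n by (auto simp: I_def s_def)
  show "algebraic_int (x + y)"
    using x y by (intro algebraic_int_if_int_span_closed[OF fin _ k(1), of _ s] k(2))
      (simp add: distrib_right int_span_add)
  show "algebraic_int (x * y)"
    using x y by (intro algebraic_int_if_int_span_closed[OF fin _ k(1), of _ s] k(2))
      (simp add: mult.assoc int_span_mult_closed)
qed

section \<open>Minimality of the degree of an irreducible polynomial\<close>

text \<open>Over the rationals, a nonzero polynomial of least degree vanishing at \<theta> divides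
  \<open>f\<close>. By irreducibility its degree is that of \<open>f\<close>, which leaves no room
  for a nonzero \<open>q\<close> of smaller degree.\<close>

lemma int_poly_eq_0_if_root_small_degree:
  fixes f q :: "int poly" and \<theta> :: "'a :: field_char_0"
  assumes irr: "irreducible (map_poly rat_of_int f)"
    and f: "poly (of_int_poly f) \<theta> = 0"
    and q: "poly (of_int_poly q) \<theta> = 0" "degree q < degree f"
  shows "q = 0"
proof (rule ccontr)
  interpret rat: map_poly_comm_ring_hom "of_rat :: rat \<Rightarrow> 'a" ..
  let ?ev = "\<lambda>q. poly (map_poly of_rat q) \<theta>"
  assume "q \<noteq> 0"
  have lift: "?ev (of_int_poly r) = poly (of_int_poly r) \<theta>" for r
    by (simp add: map_poly_map_poly o_def)
  define P where "P = (\<lambda>r. r \<noteq> 0 \<and> ?ev r = 0)"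
  have Pq: "P (of_int_poly q)" using q \<open>q \<noteq> 0\<close> by (simp add: P_def lift)
  define r where "r = arg_min degree P"
  have r: "P r" "\<And>s. P s \<Longrightarrow> degree r \<le> degree s"
    using arg_min_nat_lemma[of P "of_int_poly q" degree] Pq by (auto simp: r_def)
  let ?F = "map_poly rat_of_int f"
  \<comment> \<open>The remainder of \<open>f\<close> modulo \<open>r\<close> also vanishes at
    \<theta>, so minimality of \<open>r\<close> forces it to be 0.\<close>
  have "?ev ?F = ?ev (r * (?F div r) + ?F mod r)" by simp
  also have "\<dots> = ?ev r * ?ev (?F div r) + ?ev (?F mod r)"
    by (simp only: rat.hom_add rat.hom_mult poly_add poly_mult)
  finally have "?ev (?F mod r) = 0" using r(1) f by (simp add: P_def lift)
  then have "?F mod r = 0"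
    using r(2)[of "?F mod r"] degree_mod_less[of r ?F] r(1) by (force simp: P_def)
  then obtain s where s: "?F = r * s" by (metis mod_0_imp_dvd dvdE)
  have "r dvd 1 \<or> s dvd 1" using irr s by (rule Factorial_Ring.irreducibleD)
  then show False
  proof
    assume "r dvd 1"
    then obtain a where "r = [:a:]" unfolding is_unit_poly_iff by blast
    then show False using r(1) by (auto simp: P_def)
  next
    assume "s dvd 1"
    then have "s \<noteq> 0" "degree s = 0" by (auto simp: is_unit_iff_degree)
    then have "degree ?F = degree r" using r(1) by (simp add: s degree_mult_eq P_def)
    then show False using r(2)[OF Pq] q(2) by simp
  qed
qed

section \<open>Elements of prime order in a quotient group\<close>

text \<open>The coset of \<open>x\<close> has order dividing \<open>p\<close> but different from 1,
  so Lagrange's theorem applies in the quotient. For an infinite quotient \<open>card\<close> is 0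
  and the divisibility is trivial.\<close>

lemma (in comm_group) prime_dvd_card_rcosets:
  assumes H: "subgroup H G" and p: "prime (p :: nat)"
    and x: "x \<in> carrier G" "x \<notin> H" "x [^] p \<in> H"
  shows "p dvd card (rcosets H)"
proof -
  interpret normal H G using H by (rule subgroup_imp_normal)
  interpret Q: group "G Mod H" by (rule factorgroup_is_group)
  have X: "H #> x \<in> carrier (G Mod H)" using x by (auto simp: carrier_FactGroup)
  have "(H #> x) [^]\<^bsub>G Mod H\<^esub> p = \<one>\<^bsub>G Mod H\<^esub>"
    using x by (simp add: FactGroup_pow coset_join2 H)
  then have "Q.ord (H #> x) dvd p" using Q.pow_eq_id[OF X] by simp
  moreover have "Q.ord (H #> x) \<noteq> 1"
    using Q.ord_eq_1[OF X] x coset_join1[OF _ _ H] H by (auto dest: subgroup.subset)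
  ultimately have "Q.ord (H #> x) = p" using p prime_nat_iff by blast
  then show ?thesis
    using Q.ord_dvd_group_order[OF X] by (simp add: order_def FactGroup_def)
qed

section \<open>The ring \<int>[\<theta>] and the field \<rat>(\<theta>) inside the complex
  numbers\<close>

abbreviation "C_ring \<equiv> (ring_of_type_algebra :: complex ring)"

lemma C_ring_simps [simp]:
  "carrier C_ring = UNIV" "\<one>\<^bsub>C_ring\<^esub> = 1" "\<zero>\<^bsub>C_ring\<^esub> = 0"
  "x \<oplus>\<^bsub>C_ring\<^esub> y = x + y" "x \<otimes>\<^bsub>C_ring\<^esub> y = x * y"
  by (simp_all add: ring_of_type_algebra_def)

lemma C_ring_a_inv [simp]: "\<ominus>\<^bsub>C_ring\<^esub> x = - x"
proof -
  interpret field C_ring by (rule field_from_type_algebra)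
  show ?thesis by (rule minus_equality) auto
qed

lemma C_ring_inv [simp]: "x \<noteq> 0 \<Longrightarrow> inv\<^bsub>C_ring\<^esub> x = inverse x"
proof -
  assume "x \<noteq> 0"
  interpret field C_ring by (rule field_from_type_algebra)
  show ?thesis using \<open>x \<noteq> 0\<close> by (intro comm_inv_char) auto
qed

text \<open>The values at \<theta> of integer polynomials are closed under all generation rules.
  Conversely, Horner's scheme builds each such value from integers and \<theta> by sums and
  products.\<close>

lemma int_adjoin_eq: "int_adjoin \<theta> = range (\<lambda>q. poly (of_int_poly q) \<theta>)"
proof (intro subset_antisym subsetI)
  fix x assume "x \<in> int_adjoin \<theta>"
  then show "x \<in> range (\<lambda>q. poly (of_int_poly q) \<theta>)"
    unfolding int_adjoin_def
  proof induction
    case one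
    show ?case by (rule range_eqI[of _ _ 1]) simp
  next
    case (incl h)
    then show ?case by (intro range_eqI[of _ _ "[:0, 1:]"]) simp
  next
    case (a_inv h)
    then obtain q where "h = poly (of_int_poly q) \<theta>" by blast
    then show ?case by (intro range_eqI[of _ _ "- q"]) (simp add: hom_distribs)
  next
    case (eng_add h k)
    then obtain q r where "h = poly (of_int_poly q) \<theta>" "k = poly (of_int_poly r) \<theta>" by blast
    then show ?case by (intro range_eqI[of _ _ "q + r"]) (simp add: hom_distribs)
  next
    case (eng_mult h k)
    then obtain q r where "h = poly (of_int_poly q) \<theta>" "k = poly (of_int_poly r) \<theta>" by blast
    then show ?case by (intro range_eqI[of _ _ "q * r"]) (simp add: hom_distribs)
  qed
next
  interpret field C_ring by (rule field_from_type_algebra)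
  have add: "x + y \<in> int_adjoin \<theta>" if "x \<in> int_adjoin \<theta>" "y \<in> int_adjoin \<theta>" for x y
    using that generate_ring.eng_add[of x C_ring "{\<theta>}" y] by (simp add: int_adjoin_def)
  have mult: "x * y \<in> int_adjoin \<theta>" if "x \<in> int_adjoin \<theta>" "y \<in> int_adjoin \<theta>" for x y
    using that generate_ring.eng_mult[of x C_ring "{\<theta>}" y] by (simp add: int_adjoin_def)
  have minus: "- x \<in> int_adjoin \<theta>" if "x \<in> int_adjoin \<theta>" for x
    using that generate_ring.a_inv[of x C_ring "{\<theta>}"] by (simp add: int_adjoin_def)
  have one: "1 \<in> int_adjoin \<theta>" using generate_ring.one[of C_ring "{\<theta>}"] by (simp add: int_adjoin_def)
  \<comment> \<open>Zero is generated as 1 + (-1).\<close>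
  have zero: "0 \<in> int_adjoin \<theta>" using add[OF one minus[OF one]] by simp
  have of_int: "of_int k \<in> int_adjoin \<theta>" for k
    by (induction k rule: int_induct[of _ 0])
      (use zero one add minus in \<open>force simp: diff_conv_add_uminus simp del: add_uminus_conv_diff\<close>)+
  have theta: "\<theta> \<in> int_adjoin \<theta>" by (auto simp: int_adjoin_def intro: generate_ring.incl)
  fix x assume "x \<in> range (\<lambda>q. poly (of_int_poly q) \<theta>)"
  then obtain q where "x = poly (of_int_poly q) \<theta>" by blast
  moreover have "poly (of_int_poly q) \<theta> \<in> int_adjoin \<theta>"
    by (induction q) (auto simp: hom_distribs intro: zero add mult of_int theta)
  ultimately show "x \<in> int_adjoin \<theta>" by simp
qed

lemma rat_adjoin_closed:
  shows rat_adjoin_self: "\<theta> \<in> rat_adjoin \<theta>"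
    and rat_adjoin_1: "1 \<in> rat_adjoin \<theta>"
    and rat_adjoin_minus: "x \<in> rat_adjoin \<theta> \<Longrightarrow> - x \<in> rat_adjoin \<theta>"
    and rat_adjoin_add: "x \<in> rat_adjoin \<theta> \<Longrightarrow> y \<in> rat_adjoin \<theta> \<Longrightarrow> x + y \<in> rat_adjoin \<theta>"
    and rat_adjoin_mult: "x \<in> rat_adjoin \<theta> \<Longrightarrow> y \<in> rat_adjoin \<theta> \<Longrightarrow> x * y \<in> rat_adjoin \<theta>"
    and rat_adjoin_inverse: "x \<in> rat_adjoin \<theta> \<Longrightarrow> x \<noteq> 0 \<Longrightarrow> inverse x \<in> rat_adjoin \<theta>"
  using generate_field.one[of C_ring "{\<theta>}"] generate_field.a_inv[of x C_ring "{\<theta>}"]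
    generate_field.eng_add[of x C_ring "{\<theta>}" y] generate_field.eng_mult[of x C_ring "{\<theta>}" y]
    generate_field.m_inv[of x C_ring "{\<theta>}"] generate_field.incl[of \<theta> "{\<theta>}" C_ring]
  by (auto simp: rat_adjoin_def)

lemma int_adjoin_subset_rat_adjoin: "int_adjoin \<theta> \<subseteq> rat_adjoin \<theta>"
proof
  fix x assume "x \<in> int_adjoin \<theta>"
  then show "x \<in> rat_adjoin \<theta>"
    unfolding int_adjoin_def
    by induction (auto intro: rat_adjoin_closed)
qed

lemma algebraic_int_int_adjoin:
  assumes "algebraic_int \<theta>" "x \<in> int_adjoin \<theta>"
  shows "algebraic_int x"
  using assms(2) unfolding int_adjoin_def
  by induction (auto intro: assms(1) algebraic_int_plus algebraic_int_times)

lemma ring_of_integers_simps [simp]: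
  "carrier (ring_of_integers K) = {x \<in> K. algebraic_int x}"
  "x \<oplus>\<^bsub>ring_of_integers K\<^esub> y = x + y" "\<zero>\<^bsub>ring_of_integers K\<^esub> = 0"
  by (simp_all add: ring_of_integers_def ring_of_type_algebra_def)

section \<open>A divisibility criterion for the index\<close>

text \<open>
  Finiteness of the quotient is not an issue: if it were infinite, \<^const>\<open>index\<close> would be 0.
\<close>

lemma prime_dvd_index:
  assumes \<theta>: "algebraic_int \<theta>" and p: "prime p"
    and x: "x \<in> rat_adjoin \<theta>" "algebraic_int x" "x \<notin> int_adjoin \<theta>" "of_nat p * x \<in> int_adjoin \<theta>"
  shows "p dvd index \<theta>"
proof -
  \<comment> \<open>Additive cosets are by definition cosets in this group, so the multiplicatively
    written Lagrange argument transfers.\<close>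
  define G where "G = add_monoid (ring_of_integers (rat_adjoin \<theta>))"
  have G [simp]: "carrier G = {x \<in> rat_adjoin \<theta>. algebraic_int x}" "\<one>\<^bsub>G\<^esub> = 0"
    "\<And>x y. x \<otimes>\<^bsub>G\<^esub> y = x + y"
    by (simp_all add: G_def)
  have zero: "0 \<in> rat_adjoin \<theta>"
    using rat_adjoin_add[OF rat_adjoin_1 rat_adjoin_minus[OF rat_adjoin_1]] by simp
  interpret comm_group G
  proof (rule comm_groupI)
    fix x assume "x \<in> carrier G"
    then show "\<exists>y\<in>carrier G. y \<otimes>\<^bsub>G\<^esub> x = \<one>\<^bsub>G\<^esub>"
      by (intro bexI[of _ "- x"]) (auto intro: rat_adjoin_minus)
  qed (auto intro: rat_adjoin_add algebraic_int_plus zero)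
  have G_inv: "inv\<^bsub>G\<^esub> y = - y" if "y \<in> carrier G" for y
    using that by (intro inv_equality) (auto intro: rat_adjoin_minus)
  have sub: "int_adjoin \<theta> \<subseteq> carrier G"
    using int_adjoin_subset_rat_adjoin algebraic_int_int_adjoin[OF \<theta>] by auto
  have H: "subgroup (int_adjoin \<theta>) G"
  proof (rule subgroupI)
    show "int_adjoin \<theta> \<noteq> {}" by (auto simp: int_adjoin_eq)
    fix a assume a: "a \<in> int_adjoin \<theta>"
    then have "- a \<in> int_adjoin \<theta>"
      using generate_ring.a_inv[of a C_ring "{\<theta>}"] by (simp add: int_adjoin_def)
    then show "inv\<^bsub>G\<^esub> a \<in> int_adjoin \<theta>" using G_inv a sub by auto
    fix b assume "b \<in> int_adjoin \<theta>"
    then show "a \<otimes>\<^bsub>G\<^esub> b \<in> int_adjoin \<theta>"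
      using a generate_ring.eng_add[of a C_ring "{\<theta>}" b] by (simp add: int_adjoin_def)
  qed (fact sub)
  \<comment> \<open>Powers in the additive group are multiples, so the hypothesis on
    \<open>of_nat p * x\<close> says that the \<open>p\<close>-th power of \<open>x\<close> lies in
    the subgroup.\<close>
  have pow: "y [^]\<^bsub>G\<^esub> n = of_nat n * y" for y and n :: nat
    by (induction n) (simp_all add: algebra_simps)
  have "p dvd card (rcosets\<^bsub>G\<^esub> (int_adjoin \<theta>))"
    using x by (intro prime_dvd_card_rcosets[OF H p, of x]) (auto simp: pow)
  then show ?thesis by (simp add: index_def A_RCOSETS_def G_def)
qed

text \<open>Division of \<open>q\<close> by X - y leaves the remainder
  \<open>poly q y\<close>.\<close>

lemma poly_diff_dvd:
  fixes q :: "'a :: comm_ring_1 poly"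
  shows "x - y dvd poly q x - poly q y"
proof -
  have "poly q x = poly ([:- y, 1:] * synthetic_div q y + [:poly q y:]) x"
    by (simp only: synthetic_div_correct')
  also have "\<dots> = (x - y) * poly (synthetic_div q y) x + poly q y" by (simp add: algebra_simps)
  finally show ?thesis by simp
qed

text \<open>The two divisibilities in \<open>c\<close> place \<open>f\<close> in the square of the
  ideal (p, X - c) of \<int>[X], which makes \<int>[\<theta>] non-maximal at
  \<open>p\<close>.\<close>

lemma prime_dvd_index_if_double_root:
  fixes f :: "int poly" and p :: nat and c :: int
  assumes p: "prime p" and monic: "lead_coeff f = 1" and deg: "degree f \<ge> 2"
    and irr: "irreducible (map_poly rat_of_int f)"
    and root: "poly (of_int_poly f) \<theta> = 0"
    and c: "(int p)\<^sup>2 dvd poly f c" "int p dvd poly (pderiv f) c"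
  shows "p dvd index \<theta>"
proof -
  let ?ev = "\<lambda>q :: int poly. poly (of_int_poly q) \<theta>"
  define q1 where "q1 = synthetic_div f c"
  define q where "q = synthetic_div q1 c"
  define H where "H = [:- c, 1:] * q"
  obtain b0 where b0: "poly f c = int p ^ 2 * b0" using c(1) by blast
  have f1: "f = [:- c, 1:] * q1 + [:poly f c:]"
    by (simp only: q1_def synthetic_div_correct')
  \<comment> \<open>The product rule applied to (X - c) q1 plus a constant, evaluated at
    \<open>c\<close>.\<close>
  have "poly (pderiv f) c = poly q1 c"
    by (subst f1) (simp add: pderiv_add pderiv_mult pderiv_pCons del: mult_pCons_left)
  then obtain b1 where b1: "poly q1 c = int p * b1" using c(2) by auto
  have q1: "q1 = H + [:int p * b1:]"
    unfolding H_def q_def b1[symmetric] by (simp only: synthetic_div_correct')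
  define E where "E = [:- c, 1:] * H"
  \<comment> \<open>This is p b1 (X - c) + p^2 b0. Its degree is at most 1, so with
    \<open>degree f \<ge> 2\<close> the polynomial \<open>E\<close> inherits the degree and the
    leading coefficient of \<open>f\<close>.\<close>
  define R where "R = [:int p ^ 2 * b0 - c * (int p * b1), int p * b1:]"
  have fE: "f = E + R"
    using f1 by (simp add: E_def R_def q1 b0 algebra_simps)
  have "degree R < degree f" using deg by (simp add: R_def)
  then have E: "degree E = degree f" "lead_coeff E = 1"
    using fE monic degree_add_eq_left[of "- R" f] by (simp_all add: coeff_eq_0)
  then have "H \<noteq> 0" by (auto simp: E_def)
  have H: "Suc (degree H) = degree f" "lead_coeff H = 1"
    using E(1) \<open>H \<noteq> 0\<close> E(2)[unfolded E_def lead_coeff_mult]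
    by (auto simp: E_def degree_mult_eq simp del: mult_pCons_left)
  have ev_const: "?ev [:k:] = of_int k" for k
    by (simp add: hom_distribs)
  have \<theta>: "algebraic_int \<theta>" using root monic by (auto simp: algebraic_int_altdef_ipoly)
  define x where "x = ?ev H / of_nat p"
  have p0: "p \<noteq> 0" using p by auto
  have px: "of_nat p * x = ?ev H" using p0 by (simp add: x_def)
  have evH: "?ev H = (\<theta> - of_int c) * ?ev q" by (simp add: H_def hom_distribs algebra_simps)
  \<comment> \<open>This is the decomposition of \<open>f\<close> evaluated at \<theta>, with
    \<open>?ev H\<close> written as p x; one factor p then cancels.\<close>
  have "0 = (\<theta> - of_int c) * (of_nat p * x + of_nat p * of_int b1) + of_nat p ^ 2 * of_int b0"
    using root unfolding px by (subst (asm) f1) (simp add: q1 b0 hom_distribs algebra_simps)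
  then have "of_nat p * ((\<theta> - of_int c) * (x + of_int b1)) = of_nat p * (- of_nat p * of_int b0)"
    by (simp add: algebra_simps power2_eq_square eq_neg_iff_add_eq_0)
  then have 1: "(\<theta> - of_int c) * (x + of_int b1) = - of_nat p * of_int b0"
    using p0 by (metis mult_cancel_left of_nat_eq_0_iff)
  \<comment> \<open>Replacing p x by (\<theta> - c) q(\<theta>) brings in the relation just
    obtained, and its right-hand side supplies the factor p to cancel.\<close>
  have "of_nat p * (x * (x + of_int b1)) = (of_nat p * x) * (x + of_int b1)"
    by (rule mult.assoc[symmetric])
  also have "\<dots> = ?ev q * ((\<theta> - of_int c) * (x + of_int b1))"
    unfolding px evH by (simp only: mult_ac)
  also have "\<dots> = of_nat p * (- (of_int b0 * ?ev q))" unfolding 1 by simp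
  finally have 2: "x * (x + of_int b1) = - (of_int b0 * ?ev q)"
    using p0 by (metis mult_cancel_left of_nat_eq_0_iff)
  have Z: "?ev r \<in> int_adjoin \<theta>" for r by (simp add: int_adjoin_eq)
  have "algebraic_int (- (of_int b0 * ?ev q))"
    using algebraic_int_int_adjoin[OF \<theta> Z] by (auto intro!: algebraic_int_minus algebraic_int_times)
  \<comment> \<open>The monic integer polynomial X^2 + b1 X takes an algebraic integer as its value
    at \<open>x\<close>, which makes \<open>x\<close> integral.\<close>
  then have x_int: "algebraic_int x"
    by (rule algebraic_int_root[where p = "[:0, of_int b1, 1:]"])
       (auto simp: 2[symmetric] algebra_simps coeff_pCons split: nat.splits)
  have x_rat: "x \<in> rat_adjoin \<theta>"
  proof -
    have "of_nat p = ?ev [:int p:]" unfolding ev_const by simp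
    then have "of_nat p \<in> rat_adjoin \<theta>" using Z int_adjoin_subset_rat_adjoin by (metis subsetD)
    then show ?thesis
      unfolding x_def divide_inverse using Z int_adjoin_subset_rat_adjoin p0
      by (intro rat_adjoin_mult rat_adjoin_inverse) auto
  qed
  have "x \<notin> int_adjoin \<theta>"
  proof
    assume "x \<in> int_adjoin \<theta>"
    then obtain r where r: "x = ?ev r" by (auto simp: int_adjoin_eq)
    \<comment> \<open>Since \<open>f\<close> is monic, pseudo-division is genuine division over
      \<int>, and \<open>r\<close> may be replaced by its remainder \<open>t\<close>.\<close>
    obtain s t where st: "pseudo_divmod r f = (s, t)" by force
    have "f \<noteq> 0" using monic by auto
    note d = pseudo_divmod[OF this st]
    have "r = f * s + t" using d(1) monic by simp
    then have xt: "x = ?ev t" using root by (simp add: r hom_distribs)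
    have "degree t < degree f" using d(2) deg by auto
    \<comment> \<open>This polynomial vanishes at \<theta> and has degree below that of
      \<open>f\<close>, so it is 0; then p would divide the leading coefficient 1 of
      \<open>H\<close>.\<close>
    then have "degree (H - [:int p:] * t) < degree f"
      using H(1) by (intro degree_diff_less) auto
    moreover have "?ev (H - [:int p:] * t) = 0"
      using px by (simp add: xt hom_distribs)
    ultimately have "H - [:int p:] * t = 0"
      using int_poly_eq_0_if_root_small_degree[OF irr root] by blast
    then have "H = smult (int p) t" by simp
    then have "int p dvd lead_coeff H" by simp
    then show False using H(2) p by (simp add: prime_gt_1_nat not_prime_unit)
  qed
  with x_int x_rat px Z \<theta> p show ?thesis by (intro prime_dvd_index) auto
qed

section \<open>Polynomials in X^p\<close>

theorem theorem6p7:
  fixes p :: nat and g f :: "int poly" and \<theta> :: complex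
  assumes "prime p"
    and "lead_coeff g = 1"
    and "f = pcompose g (monom 1 p)"
    and "irreducible (map_poly rat_of_int f)"
    and "poly (map_poly of_int f) \<theta> = 0"
    and "\<exists>c\<in>{0..<int p}. [poly g (omega p c) = 0] (mod (int p)\<^sup>2)"
  shows "p dvd index \<theta> \<and> \<not> monogenic f"
proof -
  have p: "p \<ge> 2" using assms(1) by (rule prime_ge_2_nat)
  have "degree f = degree g * p" by (simp add: assms(3) degree_monom_eq)
  have monic: "lead_coeff f = 1"
    using p assms(2) lead_coeff_comp[of "monom 1 p" g] by (simp add: assms(3) degree_monom_eq)
  \<comment> \<open>An irreducible polynomial is not a unit, so \<open>g\<close> is nonconstant and
    the degree of \<open>f\<close> is at least p.\<close>
  have "degree f \<noteq> 0"
  proof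
    assume "degree f = 0"
    then have "f = 1" using monic by (auto elim!: degree_eq_zeroE)
    then show False using irreducible_not_unit[OF assms(4)] by simp
  qed
  then have deg: "degree f \<ge> 2" using \<open>degree f = degree g * p\<close> p by (cases "degree g") auto
  obtain c where "[poly g (omega p c) = 0] (mod (int p)\<^sup>2)" using assms(6) by blast
  then have "(int p)\<^sup>2 dvd poly g (omega p c)" by (simp add: cong_0_iff)
  \<comment> \<open>\<open>omega p c\<close> is only a representative of c^p modulo p^2; polynomial
    values respect the congruence.\<close>
  moreover have "(int p)\<^sup>2 dvd c ^ p - omega p c"
    unfolding omega_def by (rule dvd_minus_mod)
  then have "(int p)\<^sup>2 dvd poly g (c ^ p) - poly g (omega p c)"
    using poly_diff_dvd dvd_trans by blast
  ultimately have "(int p)\<^sup>2 dvd poly g (omega p c) + (poly g (c ^ p) - poly g (omega p c))"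
    by (rule dvd_add)
  then have "(int p)\<^sup>2 dvd poly g (c ^ p)" by simp
  then have f0: "(int p)\<^sup>2 dvd poly f c" by (simp add: assms(3) poly_pcompose poly_monom)
  \<comment> \<open>The chain rule gives the factor p, from the derivative of X^p.\<close>
  have f1: "int p dvd poly (pderiv f) c"
    by (simp add: assms(3) pderiv_pcompose pderiv_monom poly_monom)
  \<comment> \<open>\<open>monogenic\<close> asks for some root of index 1, so refuting it takes the
    divisibility at every root.\<close>
  have *: "p dvd index \<eta>" if "poly (map_poly of_int f) \<eta> = 0" for \<eta> :: complex
    using assms(1) monic deg assms(4) that f0 f1 by (rule prime_dvd_index_if_double_root)
  have "\<not> p dvd 1" using p by simp
  with * have "\<not> monogenic f" by (metis monogenic_def)
  with *[OF assms(5)] show ?thesis by blast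
qed

end
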